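(* Let $\mathbb{R}^+:=(0,\infty)$, set $K:=\mathbb{R}^+\times\mathbb{R}^+$, and fix $\alpha,\beta\in\mathbb{R}^+$. Let $\Phi:K\to\mathbb{R}^+$ be a continuous function such that $\lim_{x\to(0,0)}\Phi(x)=0$. Then $\Phi$ satisfies $$\Phi(\alpha x+\beta y)=\alpha\,\Phi(x)+\beta\,\Phi(y)\qquad\text{for all }x,y\in K$$ if and only if there exists $y\in\mathbb{R}^2$ such that $\Phi(x)=\langle x,y\rangle$ for all $x\in K$.
   Context: $\langle\cdot,\cdot\rangle$ denotes the standard inner product on $\mathbb{R}^2$. The limit is taken over $x\in K$. *)

theory Defs
  imports "HOL-Analysis.Analysis"
begin

abbreviation pos_reals :: "real set" where
  "pos_reals \<equiv> {0<..}"

text \<open>The plane is the product type \<^typ>\<open>real \<times> real\<close>, whose topology is the Euclidean one and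
  whose library inner product is the standard one, \<open>(a, b) \<bullet> (c, d) = a * c + b * d\<close>.\<close>

definition quadrant :: "(real \<times> real) set" where
  "quadrant = pos_reals \<times> pos_reals"

end

theory Submission
  imports Defs
begin

text \<open>Letting \<open>y\<close>, respectively \<open>x\<close>, tend to the origin in the functional equation gives
  \<open>\<Phi> (\<alpha> x) = \<alpha> \<Phi> x\<close> and \<open>\<Phi> (\<beta> y) = \<beta> \<Phi> y\<close>, so the equation says that \<open>\<Phi>\<close> is additive. On each
  ray a positive additive function is monotone, hence homogeneous. An additive and
  positively homogeneous function on the quadrant is determined by its values at
  \<open>(2, 1)\<close> and \<open>(1, 2)\<close>: although \<open>x\<close> need not be a positive combination of these two vectors, it
  becomes one after a large multiple of their sum is added.\<close>

text \<open>Monotonicity traps \<open>f\<close> between its values at consecutive integers, so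
  \<open>f x\<close> differs from \<open>x * f 1\<close> by at most \<open>f 1\<close>. Along the
  multiples of \<open>t\<close> this deviation grows linearly, so it must vanish.\<close>

lemma additive_nonneg_imp_linear:
  fixes f :: "real \<Rightarrow> real"
  assumes add: "\<And>s t. 0 < s \<Longrightarrow> 0 < t \<Longrightarrow> f (s + t) = f s + f t"
    and nonneg: "\<And>t. 0 < t \<Longrightarrow> 0 \<le> f t"
    and "0 < t"
  shows "f t = t * f 1"
proof -
  have mono: "f s \<le> f t" if "0 < s" "s \<le> t" for s t
  proof (cases "s = t")
    case False
    then show ?thesis
      using add[of s "t - s"] nonneg[of "t - s"] that by simp
  qed simp
  have mult: "f (real (Suc n) * t) = real (Suc n) * f t" if "0 < t" for n t
  proof (induction n)
    case (Suc n)
    have "f (real (Suc n) * t + t) = f (real (Suc n) * t) + f t"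
      using that by (intro add) auto
    then show ?case
      using Suc by (simp add: algebra_simps)
  qed simp
  have bound: "real (Suc n) * \<bar>f t - t * f 1\<bar> \<le> f 1" for n
  proof -
    define x where "x = real (Suc n) * t"
    define m where "m = nat \<lfloor>x\<rfloor>"
    have "0 < x"
      using \<open>0 < t\<close> by (simp add: x_def)
    then have m: "real m \<le> x" "x < real m + 1"
      unfolding m_def by linarith+
    have upper: "f x \<le> (real m + 1) * f 1"
      using mono[of x "real (Suc m)"] mult[of 1 m] m \<open>0 < x\<close> by (simp add: add.commute)
    have lower: "real m * f 1 \<le> f x"
    \<comment> \<open>\<open>mult\<close> covers only positive multiples and nothing is known about
      \<open>f 0\<close>, so \<open>m = 0\<close> falls back on nonnegativity.\<close>
    proof (cases m)
      case 0
      then show ?thesis using nonneg[OF \<open>0 < x\<close>] by simp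
    next
      case (Suc k)
      then show ?thesis using mono[of "real m" x] mult[of 1 k] m by simp
    qed
    have "real m * f 1 \<le> x * f 1" "x * f 1 \<le> (real m + 1) * f 1"
      using m nonneg[of 1] by (auto intro!: mult_right_mono)
    with upper lower have "\<bar>f x - x * f 1\<bar> \<le> f 1"
      by (simp add: algebra_simps abs_le_iff)
    moreover have "f x - x * f 1 = real (Suc n) * (f t - t * f 1)"
      using mult[OF \<open>0 < t\<close>, of n] unfolding x_def by (simp add: algebra_simps)
    ultimately show ?thesis
      by (simp add: abs_mult)
  qed
  show ?thesis
  proof (rule ccontr)
    assume "f t \<noteq> t * f 1"
    then have "0 < \<bar>f t - t * f 1\<bar>" by simp
    then obtain n where "f 1 < real n * \<bar>f t - t * f 1\<bar>"
      using reals_Archimedean3 by blast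
    also have "\<dots> \<le> real (Suc n) * \<bar>f t - t * f 1\<bar>"
      by (intro mult_right_mono) auto
    finally show False
      using bound[of n] by simp
  qed
qed

lemma open_quadrant: "open quadrant"
  unfolding quadrant_def by (intro open_Times) auto

lemma quadrant_add: "x \<in> quadrant \<Longrightarrow> y \<in> quadrant \<Longrightarrow> x + y \<in> quadrant"
  by (auto simp: quadrant_def)

lemma quadrant_scaleR: "0 < c \<Longrightarrow> x \<in> quadrant \<Longrightarrow> c *\<^sub>R x \<in> quadrant"
  by (auto simp: quadrant_def)

text \<open>The diagonal reaches the origin through the quadrant. Nontriviality of the filter is
  what makes limits along it unique.\<close>

lemma zero_limit_of_quadrant: "at (0, 0) within quadrant \<noteq> bot"
proof -
  have "((\<lambda>t::real. (t, t)) \<longlongrightarrow> (0, 0)) (at_right 0)"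
    by (intro tendsto_intros)
  moreover have "\<forall>\<^sub>F t in at_right (0::real). (t, t) \<in> quadrant \<and> (t, t) \<noteq> (0, 0)"
    using eventually_at_right_less[of "0::real"]
    by eventually_elim (simp add: quadrant_def)
  ultimately have "filterlim (\<lambda>t::real. (t, t)) (at (0, 0) within quadrant) (at_right 0)"
    by (simp add: filterlim_at)
  then show ?thesis
    by (metis filterlim_def filtermap_bot_iff le_bot trivial_limit_at_right_real)
qed

text \<open>As \<open>y\<close> tends to the origin, the left side of the equation tends to
  \<open>\<Phi> (\<alpha> *\<^sub>R x)\<close> by continuity and the right side to
  \<open>\<alpha> * \<Phi> x\<close>. The point \<open>x\<close> is fixed, so that either argument
  of the equation can play its role.\<close>

lemma homogeneous_from_limit:
  fixes \<Phi> :: "real \<times> real \<Rightarrow> real"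
  assumes "0 < \<alpha>"
    and cont: "continuous_on quadrant \<Phi>"
    and lim: "(\<Phi> \<longlongrightarrow> 0) (at (0, 0) within quadrant)"
    and eq: "\<And>y. y \<in> quadrant \<Longrightarrow> \<Phi> (\<alpha> *\<^sub>R x + \<beta> *\<^sub>R y) = \<alpha> * \<Phi> x + \<beta> * \<Phi> y"
    and x: "x \<in> quadrant"
  shows "\<Phi> (\<alpha> *\<^sub>R x) = \<alpha> * \<Phi> x"
proof -
  let ?F = "at (0, 0) within quadrant :: (real \<times> real) filter"
  have "((\<lambda>y. \<alpha> *\<^sub>R x + \<beta> *\<^sub>R y) \<longlongrightarrow> \<alpha> *\<^sub>R x + \<beta> *\<^sub>R (0, 0)) ?F"
    by (intro tendsto_intros)
  then have arg: "((\<lambda>y. \<alpha> *\<^sub>R x + \<beta> *\<^sub>R y) \<longlongrightarrow> \<alpha> *\<^sub>R x) ?F"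
    by (simp flip: zero_prod_def)
  \<comment> \<open>The quadrant is open, so continuity on it is continuity at each of its
    points.\<close>
  have "isCont \<Phi> (\<alpha> *\<^sub>R x)"
    using cont open_quadrant quadrant_scaleR[OF \<open>0 < \<alpha>\<close> x]
    by (simp add: continuous_on_eq_continuous_at)
  from isCont_tendsto_compose[OF this arg]
  have "((\<lambda>y. \<Phi> (\<alpha> *\<^sub>R x + \<beta> *\<^sub>R y)) \<longlongrightarrow> \<Phi> (\<alpha> *\<^sub>R x)) ?F" .
  moreover have "\<forall>\<^sub>F y in ?F. \<Phi> (\<alpha> *\<^sub>R x + \<beta> *\<^sub>R y) = \<alpha> * \<Phi> x + \<beta> * \<Phi> y"
    using eq by (auto simp: eventually_at_filter)
  ultimately have "((\<lambda>y. \<alpha> * \<Phi> x + \<beta> * \<Phi> y) \<longlongrightarrow> \<Phi> (\<alpha> *\<^sub>R x)) ?F"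
    by (rule Lim_transform_eventually)
  moreover have "((\<lambda>y. \<alpha> * \<Phi> x + \<beta> * \<Phi> y) \<longlongrightarrow> \<alpha> * \<Phi> x + \<beta> * 0) ?F"
    by (intro tendsto_intros lim)
  ultimately show ?thesis
    using tendsto_unique[OF zero_limit_of_quadrant] by fastforce
qed

lemma additive_homogeneous_imp_inner:
  fixes \<Phi> :: "real \<times> real \<Rightarrow> real"
  assumes add: "\<And>x y. x \<in> quadrant \<Longrightarrow> y \<in> quadrant \<Longrightarrow> \<Phi> (x + y) = \<Phi> x + \<Phi> y"
    and hom: "\<And>c x. 0 < c \<Longrightarrow> x \<in> quadrant \<Longrightarrow> \<Phi> (c *\<^sub>R x) = c * \<Phi> x"
  shows "\<exists>y. \<forall>x\<in>quadrant. \<Phi> x = x \<bullet> y"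
proof -
  \<comment> \<open>The standard basis vectors lie on the boundary, outside the quadrant;
    \<open>u\<close> and \<open>v\<close> form a basis inside it.\<close>
  define u v :: "real \<times> real" where "u = (2, 1)" and "v = (1, 2)"
  have uv: "u \<in> quadrant" "v \<in> quadrant"
    by (auto simp: u_def v_def quadrant_def)
  have comb: "\<Phi> (s *\<^sub>R u + t *\<^sub>R v) = s * \<Phi> u + t * \<Phi> v" if "0 < s" "0 < t" for s t
    using add[OF quadrant_scaleR quadrant_scaleR] hom that uv by simp
  \<comment> \<open>The solution of the linear system \<open>u \<bullet> w = \<Phi> u\<close>,
    \<open>v \<bullet> w = \<Phi> v\<close>.\<close>
  define w where "w = ((2 * \<Phi> u - \<Phi> v) / 3, (2 * \<Phi> v - \<Phi> u) / 3)"
  have "\<Phi> x = x \<bullet> w" if x: "x \<in> quadrant" for x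
  proof -
    obtain a b where ab: "x = (a, b)" "0 < a" "0 < b"
      using x by (auto simp: quadrant_def)
    \<comment> \<open>Here \<open>x = s *\<^sub>R u + t *\<^sub>R v\<close>, where \<open>s\<close>
      or \<open>t\<close> may fail to be positive. The shift \<open>N\<close> repairs this:
      \<open>N + s = (5 * a + 2 * b) / 3\<close> and
      \<open>N + t = (2 * a + 5 * b) / 3\<close>.\<close>
    define N s t where "N = a + b" and "s = (2 * a - b) / 3" and "t = (2 * b - a) / 3"
    have pos: "0 < N" "0 < N + s" "0 < N + t"
      using ab by (auto simp: N_def s_def t_def field_simps)
    have "x + (N *\<^sub>R u + N *\<^sub>R v) = (N + s) *\<^sub>R u + (N + t) *\<^sub>R v"
      by (simp add: ab u_def v_def s_def t_def field_simps)
    then have "\<Phi> x + (N * \<Phi> u + N * \<Phi> v) = (N + s) * \<Phi> u + (N + t) * \<Phi> v"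
      using add[OF x quadrant_add, of "N *\<^sub>R u" "N *\<^sub>R v"] comb pos uv quadrant_scaleR by simp
    then have "\<Phi> x = s * \<Phi> u + t * \<Phi> v"
      by (simp add: algebra_simps)
    then show ?thesis
      by (simp add: ab w_def s_def t_def field_simps)
  qed
  then show ?thesis by blast
qed

theorem corollary1p4:
  fixes \<alpha> \<beta> :: real
    and \<Phi> :: "real \<times> real \<Rightarrow> real"
  assumes "\<alpha> \<in> pos_reals"
    and "\<beta> \<in> pos_reals"
    and "\<Phi> \<in> quadrant \<rightarrow> pos_reals"
    and "continuous_on quadrant \<Phi>"
    and "(\<Phi> \<longlongrightarrow> 0) (at (0, 0) within quadrant)"
  shows "(\<forall>x\<in>quadrant. \<forall>y\<in>quadrant.
            \<Phi> (\<alpha> *\<^sub>R x + \<beta> *\<^sub>R y) = \<alpha> * \<Phi> x + \<beta> * \<Phi> y)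
         \<longleftrightarrow> (\<exists>y :: real \<times> real. \<forall>x\<in>quadrant. \<Phi> x = x \<bullet> y)"
proof
  assume eq: "\<forall>x\<in>quadrant. \<forall>y\<in>quadrant.
    \<Phi> (\<alpha> *\<^sub>R x + \<beta> *\<^sub>R y) = \<alpha> * \<Phi> x + \<beta> * \<Phi> y"
  have pos: "0 < \<alpha>" "0 < \<beta>"
    using assms by auto
  have hom_\<alpha>: "\<Phi> (\<alpha> *\<^sub>R x) = \<alpha> * \<Phi> x" if "x \<in> quadrant" for x
    using eq that by (intro homogeneous_from_limit[OF pos(1) assms(4,5)]) auto
  \<comment> \<open>The same limit argument with the two summands exchanged.\<close>
  have hom_\<beta>: "\<Phi> (\<beta> *\<^sub>R y) = \<beta> * \<Phi> y" if "y \<in> quadrant" for y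
    using eq that
    by (intro homogeneous_from_limit[OF pos(2) assms(4,5), where \<beta> = \<alpha>])
      (auto simp: add.commute)
  have add: "\<Phi> (x + y) = \<Phi> x + \<Phi> y" if xy: "x \<in> quadrant" "y \<in> quadrant" for x y
  proof -
    \<comment> \<open>Rescaling turns \<open>x + y\<close> into the left side of the equation; the
      two homogeneity facts then absorb the factors.\<close>
    define x' y' where "x' = (1 / \<alpha>) *\<^sub>R x" and "y' = (1 / \<beta>) *\<^sub>R y"
    have "x = \<alpha> *\<^sub>R x'" "y = \<beta> *\<^sub>R y'" "x' \<in> quadrant" "y' \<in> quadrant"
      using pos xy quadrant_scaleR[of "1 / \<alpha>"] quadrant_scaleR[of "1 / \<beta>"]
      by (auto simp: x'_def y'_def)
    then show ?thesis
      using eq hom_\<alpha> hom_\<beta> by simp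
  qed
  have hom: "\<Phi> (c *\<^sub>R x) = c * \<Phi> x" if "0 < c" "x \<in> quadrant" for c x
  proof -
    \<comment> \<open>Restricting to the ray through \<open>x\<close> reduces homogeneity to the
      one-variable lemma.\<close>
    have "\<Phi> ((s + t) *\<^sub>R x) = \<Phi> (s *\<^sub>R x) + \<Phi> (t *\<^sub>R x)" if "0 < s" "0 < t" for s t
      using add quadrant_scaleR that \<open>x \<in> quadrant\<close> by (simp add: scaleR_add_left)
    moreover have "0 \<le> \<Phi> (t *\<^sub>R x)" if "0 < t" for t
      using funcset_mem[OF assms(3) quadrant_scaleR[OF that \<open>x \<in> quadrant\<close>]] by simp
    ultimately show ?thesis
      using additive_nonneg_imp_linear[of "\<lambda>t. \<Phi> (t *\<^sub>R x)" c] \<open>0 < c\<close> by simp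
  qed
  show "\<exists>y. \<forall>x\<in>quadrant. \<Phi> x = x \<bullet> y"
    using add hom by (rule additive_homogeneous_imp_inner)
next
  assume "\<exists>y. \<forall>x\<in>quadrant. \<Phi> x = x \<bullet> y"
  then obtain w where "\<And>x. x \<in> quadrant \<Longrightarrow> \<Phi> x = x \<bullet> w" by blast
  then show "\<forall>x\<in>quadrant. \<forall>y\<in>quadrant.
      \<Phi> (\<alpha> *\<^sub>R x + \<beta> *\<^sub>R y) = \<alpha> * \<Phi> x + \<beta> * \<Phi> y"
    using assms(1,2) by (simp add: quadrant_add quadrant_scaleR inner_add_left)
qed

end
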